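(* Let $A$ be a unital $C^*$-algebra and let $a\in A_+^{-1}$. Then $a$ is central in $A$ if and only if $a^2\le x^2$ holds for every $x\in A_+^{-1}$ with $a\le x$.
   Context: For a unital $C^*$-algebra $A$, $A_+^{-1}$ denotes the positive definite cone of $A$, i.e. the set of all positive invertible elements of $A$. The order $\le$ is the usual order on self-adjoint elements: $a\le b$ iff $b-a$ is positive. *)

theory Defs
  imports Complex_Main
begin

text \<open>
  A unital \<open>C\<^sup>*\<close>-algebra: a complex Banach algebra with unit and a conjugate-linear,
  antimultiplicative involution satisfying the \<open>C\<^sup>*\<close>-identity. The distribution provides only
  real Banach algebras (\<^class>\<open>real_normed_algebra_1\<close> together with \<^class>\<open>banach\<close>); the complex
  scalar multiplication is added here and is required to extend the real one.
  As usual, the algebra is nonzero (\<open>0 \<noteq> 1\<close>, inherited from \<^class>\<open>real_normed_algebra_1\<close>).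
\<close>

class cstar_algebra = real_normed_algebra_1 + banach +
  fixes scaleC :: "complex \<Rightarrow> 'a \<Rightarrow> 'a" (infixr \<open>*\<^sub>C\<close> 75)
    and adj :: "'a \<Rightarrow> 'a"
  assumes scaleC_add_right: "c *\<^sub>C (x + y) = c *\<^sub>C x + c *\<^sub>C y"
    and scaleC_add_left: "(c + d) *\<^sub>C x = c *\<^sub>C x + d *\<^sub>C x"
    and scaleC_scaleC: "c *\<^sub>C (d *\<^sub>C x) = (c * d) *\<^sub>C x"
    and scaleC_of_real: "complex_of_real r *\<^sub>C x = r *\<^sub>R x"
    and mult_scaleC_left: "(c *\<^sub>C x) * y = c *\<^sub>C (x * y)"
    and mult_scaleC_right: "x * (c *\<^sub>C y) = c *\<^sub>C (x * y)"
    and norm_scaleC: "norm (c *\<^sub>C x) = cmod c * norm x"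
    and adj_adj: "adj (adj x) = x"
    and adj_add: "adj (x + y) = adj x + adj y"
    and adj_scaleC: "adj (c *\<^sub>C x) = cnj c *\<^sub>C adj x"
    and adj_mult: "adj (x * y) = adj y * adj x"
    and cstar_identity: "norm (adj x * x) = (norm x)\<^sup>2"

definition cstar_invertible :: "'a::cstar_algebra \<Rightarrow> bool" where
  "cstar_invertible a \<longleftrightarrow> (\<exists>b. a * b = 1 \<and> b * a = 1)"

definition cstar_spectrum :: "'a::cstar_algebra \<Rightarrow> complex set" where
  "cstar_spectrum a = {z. \<not> cstar_invertible (z *\<^sub>C 1 - a)}"

definition cstar_selfadjoint :: "'a::cstar_algebra \<Rightarrow> bool" where
  "cstar_selfadjoint a \<longleftrightarrow> adj a = a"

definition cstar_positive :: "'a::cstar_algebra \<Rightarrow> bool" where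
  "cstar_positive a \<longleftrightarrow> cstar_selfadjoint a \<and> cstar_spectrum a \<subseteq> complex_of_real ` {0..}"

definition cstar_le :: "'a::cstar_algebra \<Rightarrow> 'a \<Rightarrow> bool" (infix \<open>\<le>\<^sub>C\<close> 50) where
  "a \<le>\<^sub>C b \<longleftrightarrow> cstar_selfadjoint a \<and> cstar_selfadjoint b \<and> cstar_positive (b - a)"

text \<open>The positive definite cone \<open>A\<^sub>+\<^sup>-\<^sup>1\<close>.\<close>

definition cstar_pos_def_cone :: "'a::cstar_algebra set" where
  "cstar_pos_def_cone = {a. cstar_positive a \<and> cstar_invertible a}"

definition cstar_central :: "'a::cstar_algebra \<Rightarrow> bool" where
  "cstar_central a \<longleftrightarrow> (\<forall>x. a * x = x * a)"

end

theory Submission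
  imports Defs "HOL-Analysis.Analysis"
begin

text \<open>
  If \<open>a\<close> is central and \<open>x = a + y\<close> with \<open>y \<ge> 0\<close>, then \<open>x\<^sup>2 - a\<^sup>2 = y\<^sup>2 + 2 a y \<ge> 0\<close>. Conversely, inserting
  \<open>x = a + t y\<close> and letting \<open>t\<close> tend to \<open>0\<close> gives \<open>a y + y a \<ge> 0\<close> for all \<open>y \<ge> 0\<close>. For self-adjoint \<open>b\<close> and
  complex \<open>z\<close> put \<open>w = exp (z b)\<close> and \<open>y = w\<^sup>* w\<close>: then \<open>w a w\<^sup>-\<^sup>1\<close> has positive real part for all \<open>z\<close>, and a
  Liouville argument shows that this entire function is constant, so that its linear coefficient \<open>b a - a b\<close> vanishes.
  The only spectral theory needed is that the norm of a self-adjoint element is its spectral radius,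
  which makes the positive elements a convex cone.
\<close>

section \<open>Scalars, adjoints and invertibility\<close>

lemma scaleC_one [simp]: "1 *\<^sub>C x = (x::'a::cstar_algebra)"
  using scaleC_of_real[of 1 x] by simp

lemma scaleC_zero_left [simp]: "0 *\<^sub>C x = (0::'a::cstar_algebra)"
  using scaleC_of_real[of 0 x] by simp

lemma scaleC_zero_right [simp]: "c *\<^sub>C 0 = (0::'a::cstar_algebra)"
  using scaleC_add_right[of c 0 0] by simp

lemma scaleC_minus_left [simp]: "(- c) *\<^sub>C x = - (c *\<^sub>C (x::'a::cstar_algebra))"
  using scaleC_add_left[of c "-c" x] by (simp add: add_eq_0_iff)

lemma scaleC_minus_right [simp]: "c *\<^sub>C (- x) = - (c *\<^sub>C (x::'a::cstar_algebra))"
  using scaleC_add_right[of c x "-x"] by (simp add: add_eq_0_iff)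

lemma scaleC_diff_left: "(c - d) *\<^sub>C x = c *\<^sub>C x - d *\<^sub>C (x::'a::cstar_algebra)"
  using scaleC_add_left[of c "-d" x] by simp

lemma scaleC_diff_right: "c *\<^sub>C (x - y) = c *\<^sub>C x - c *\<^sub>C (y::'a::cstar_algebra)"
  using scaleC_add_right[of c x "-y"] by simp

lemma scaleC_sum_left: "(\<Sum>i\<in>I. f i) *\<^sub>C x = (\<Sum>i\<in>I. f i *\<^sub>C (x::'a::cstar_algebra))"
  by (induction I rule: infinite_finite_induct) (simp_all add: scaleC_add_left)

lemma scaleC_sum_right: "c *\<^sub>C (\<Sum>i\<in>I. f i) = (\<Sum>i\<in>I. c *\<^sub>C (f i::'a::cstar_algebra))"
  by (induction I rule: infinite_finite_induct) (simp_all add: scaleC_add_right)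

lemma scaleC_of_real_one: "complex_of_real r *\<^sub>C 1 = (of_real r :: 'a::cstar_algebra)"
  by (subst scaleC_of_real) (simp add: of_real_def)

lemma scaleC_scaleR: "c *\<^sub>C (r *\<^sub>R x) = (c * complex_of_real r) *\<^sub>C (x::'a::cstar_algebra)"
  by (simp add: scaleC_scaleC flip: scaleC_of_real)

lemma scaleR_scaleC: "r *\<^sub>R (c *\<^sub>C x) = (complex_of_real r * c) *\<^sub>C (x::'a::cstar_algebra)"
  by (simp add: scaleC_scaleC flip: scaleC_of_real)

lemma scaleC_power: "(c *\<^sub>C x) ^ n = c ^ n *\<^sub>C (x::'a::cstar_algebra) ^ n"
  by (induction n) (simp_all add: mult_scaleC_left mult_scaleC_right scaleC_scaleC mult.commute)

lemma adj_zero [simp]: "adj 0 = (0::'a::cstar_algebra)"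
  using adj_add[of 0 "0::'a"] by simp

lemma adj_minus [simp]: "adj (- x) = - adj (x::'a::cstar_algebra)"
  using adj_add[of x "-x"] by (simp add: add_eq_0_iff)

lemma adj_diff: "adj (x - y) = adj x - adj (y::'a::cstar_algebra)"
  using adj_add[of x "-y"] by simp

lemma adj_one [simp]: "adj 1 = (1::'a::cstar_algebra)"
  by (metis adj_adj adj_mult mult_1)

lemma adj_scaleR: "adj (r *\<^sub>R x) = r *\<^sub>R adj (x::'a::cstar_algebra)"
  by (metis adj_scaleC complex_cnj_complex_of_real scaleC_of_real)

lemma adj_of_real [simp]: "adj (of_real r) = (of_real r::'a::cstar_algebra)"
  by (simp add: of_real_def adj_scaleR)

lemma adj_power: "adj (x ^ n) = adj (x::'a::cstar_algebra) ^ n"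
  by (induction n) (simp_all add: adj_mult power_commutes)

lemma adj_sum: "adj (\<Sum>i\<in>I. f i) = (\<Sum>i\<in>I. adj (f i::'a::cstar_algebra))"
  by (induction I rule: infinite_finite_induct) (simp_all add: adj_add)

text \<open>The C*-identity and submultiplicativity bound the square of \<open>norm y\<close> by
  \<open>norm (adj y) * norm y\<close>. Cancelling \<open>norm y\<close> and using this for both
  \<open>x\<close> and \<open>adj x\<close> gives equality.\<close>

lemma norm_adj [simp]: "norm (adj x) = norm (x::'a::cstar_algebra)"
proof -
  have le: "norm y \<le> norm (adj y)" for y :: 'a
  proof (cases "y = 0")
    case False
    have "norm y * norm y \<le> norm (adj y) * norm y"
      using cstar_identity[of y] norm_mult_ineq[of "adj y" y] by (simp add: power2_eq_square)
    then show ?thesis using False by simp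
  qed simp
  from le[of x] le[of "adj x"] show ?thesis by (simp add: adj_adj)
qed

lemma bounded_linear_adj: "bounded_linear (adj :: 'a::cstar_algebra \<Rightarrow> 'a)"
  by (rule bounded_linear_intro[of _ 1]) (simp_all add: adj_add adj_scaleR)

lemma adj_exp: "adj (exp x) = exp (adj (x::'a::cstar_algebra))"
proof -
  have "(\<lambda>n. adj (x ^ n /\<^sub>R fact n)) sums adj (exp x)"
    by (rule bounded_linear.sums[OF bounded_linear_adj exp_converges])
  then have "(\<lambda>n. adj x ^ n /\<^sub>R fact n) sums adj (exp x)"
    by (simp add: adj_scaleR adj_power)
  then show ?thesis using exp_converges sums_unique2 by blast
qed

section \<open>Inverses and the Neumann series\<close>

lemma cstar_invertible_one [simp]: "cstar_invertible (1::'a::cstar_algebra)"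
  unfolding cstar_invertible_def by (rule exI[of _ 1]) simp

lemma cstar_invertibleI:
  fixes x :: "'a::cstar_algebra"
  assumes "b * x = 1" "x * c = 1"
  shows "cstar_invertible x"
proof -
  have "b = c" using assms by (metis mult.assoc mult_1 mult_1_right)
  then show ?thesis using assms by (auto simp: cstar_invertible_def)
qed

lemma cstar_invertible_mult:
  fixes x y :: "'a::cstar_algebra"
  assumes "cstar_invertible x" "cstar_invertible y"
  shows "cstar_invertible (x * y)"
proof -
  obtain u v where uv: "x * u = 1" "u * x = 1" "y * v = 1" "v * y = 1"
    using assms by (auto simp: cstar_invertible_def)
  have "(x * y) * (v * u) = x * (y * v) * u" "(v * u) * (x * y) = v * (u * x) * y"
    by (simp_all add: mult.assoc)
  then show ?thesis using uv unfolding cstar_invertible_def by (metis mult_1_right)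
qed

lemma cstar_invertible_scaleC_iff:
  assumes "c \<noteq> 0"
  shows "cstar_invertible (c *\<^sub>C x) \<longleftrightarrow> cstar_invertible (x::'a::cstar_algebra)"
proof -
  have imp: "cstar_invertible (d *\<^sub>C y)" if d: "d \<noteq> 0" "cstar_invertible y" for d and y :: 'a
  proof -
    obtain b where "y * b = 1" "b * y = 1"
      using d unfolding cstar_invertible_def by blast
    then show ?thesis using d
      by (intro cstar_invertibleI[of "inverse d *\<^sub>C b" _ "inverse d *\<^sub>C b"])
        (simp_all add: mult_scaleC_left mult_scaleC_right scaleC_scaleC)
  qed
  have "inverse c *\<^sub>C (c *\<^sub>C x) = x"
    using assms by (simp add: scaleC_scaleC)
  then show ?thesis using imp assms by (metis nonzero_imp_inverse_nonzero)
qed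

lemma cstar_invertible_minus_iff [simp]:
  "cstar_invertible (- x) \<longleftrightarrow> cstar_invertible (x::'a::cstar_algebra)"
  using cstar_invertible_scaleC_iff[of "-1" x] by simp

text \<open>The factor \<open>1 - x\<close> stands on the right so that a right inverse of it can
  later be cancelled behind the geometric sum.\<close>

lemma one_diff_power_noncomm:
  "1 - x ^ n = (\<Sum>i<n. x ^ i) * (1 - x)" for x :: "'a::ring_1"
  by (induction n) (simp_all add: algebra_simps power_commutes)

text \<open>Neumann series: the geometric series converges by completeness, and splitting off its
  first term shows that it inverts \<open>1 - x\<close> from both sides.\<close>

lemma cstar_invertible_one_diff:
  fixes x :: "'a::cstar_algebra"
  assumes "norm x < 1"
  shows "cstar_invertible (1 - x)"
proof -
  define s where "s = (\<Sum>n. x ^ n)"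
  have sm: "summable (\<lambda>n. x ^ n)" by (rule complete_algebra_summable_geometric[OF assms])
  then have s: "s = 1 + (\<Sum>n. x ^ Suc n)"
    unfolding s_def by (subst suminf_split_head) simp_all
  have "(\<Sum>n. x ^ Suc n) = x * s" "(\<Sum>n. x ^ Suc n) = s * x"
    unfolding s_def using suminf_mult[OF sm, of x] suminf_mult2[OF sm, of x]
    by (simp_all add: power_commutes)
  with s have "s * (1 - x) = 1" "(1 - x) * s = 1"
    by (simp_all add: algebra_simps)
  then show ?thesis by (rule cstar_invertibleI)
qed

section \<open>Spectra\<close>

text \<open>For \<open>z\<close> of modulus above \<open>norm x\<close>, pulling the scalar
  \<open>z\<close> out of \<open>z *\<^sub>C 1 - x\<close> reduces invertibility to the Neumann
  series.\<close>

lemma cstar_spectrum_norm_le: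
  fixes x :: "'a::cstar_algebra"
  assumes "z \<in> cstar_spectrum x"
  shows "cmod z \<le> norm x"
proof (rule ccontr)
  assume *: "\<not> cmod z \<le> norm x"
  then have z: "z \<noteq> 0" by auto
  have "norm (inverse z *\<^sub>C x) < 1"
    using * z by (simp add: norm_scaleC norm_inverse divide_less_eq flip: divide_inverse_commute)
  then have "cstar_invertible (z *\<^sub>C (1 - inverse z *\<^sub>C x))"
    using z by (simp add: cstar_invertible_scaleC_iff cstar_invertible_one_diff)
  then show False
    using assms z by (simp add: cstar_spectrum_def scaleC_diff_right scaleC_scaleC)
qed

lemma cstar_spectrum_diff:
  fixes x :: "'a::cstar_algebra"
  shows "z \<in> cstar_spectrum (w *\<^sub>C 1 - x) \<longleftrightarrow> w - z \<in> cstar_spectrum x"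
proof -
  have "z *\<^sub>C 1 - (w *\<^sub>C 1 - x) = - ((w - z) *\<^sub>C 1 - x)"
    by (simp add: scaleC_diff_left)
  then show ?thesis by (simp only: cstar_spectrum_def cstar_invertible_minus_iff mem_Collect_eq)
qed

lemma cstar_spectrum_add:
  fixes x :: "'a::cstar_algebra"
  shows "z \<in> cstar_spectrum (x + w *\<^sub>C 1) \<longleftrightarrow> z - w \<in> cstar_spectrum x"
proof -
  have "z *\<^sub>C 1 - (x + w *\<^sub>C 1) = (z - w) *\<^sub>C 1 - x"
    by (simp add: scaleC_diff_left)
  then show ?thesis by (simp only: cstar_spectrum_def mem_Collect_eq)
qed

section \<open>Self-adjoint elements and the reality of their spectra\<close>

lemma cstar_selfadjoint_add:
  "cstar_selfadjoint x \<Longrightarrow> cstar_selfadjoint y \<Longrightarrow> cstar_selfadjoint (x + y :: 'a::cstar_algebra)"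
  by (simp add: cstar_selfadjoint_def adj_add)

lemma cstar_selfadjoint_diff:
  "cstar_selfadjoint x \<Longrightarrow> cstar_selfadjoint y \<Longrightarrow> cstar_selfadjoint (x - y :: 'a::cstar_algebra)"
  by (simp add: cstar_selfadjoint_def adj_diff)

lemma cstar_selfadjoint_of_real [simp]: "cstar_selfadjoint (of_real r :: 'a::cstar_algebra)"
  by (simp add: cstar_selfadjoint_def)

lemma cstar_selfadjoint_scaleR:
  "cstar_selfadjoint x \<Longrightarrow> cstar_selfadjoint (r *\<^sub>R x :: 'a::cstar_algebra)"
  by (simp add: cstar_selfadjoint_def adj_scaleR)

lemma cstar_selfadjoint_power:
  "cstar_selfadjoint x \<Longrightarrow> cstar_selfadjoint (x ^ n :: 'a::cstar_algebra)"
  by (simp add: cstar_selfadjoint_def adj_power)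

text \<open>Shifting \<open>x\<close> by \<open>it\<close> moves the spectral point \<open>z\<close> to \<open>z + it\<close>, while the norm squared
  grows by at most \<open>t\<^sup>2\<close>; for large \<open>t\<close> of the sign of \<open>Im z\<close> this is impossible.\<close>

lemma cstar_selfadjoint_spectrum_real:
  fixes x :: "'a::cstar_algebra"
  assumes sa: "cstar_selfadjoint x" and z: "z \<in> cstar_spectrum x"
  shows "Im z = 0"
proof (rule ccontr)
  assume nz: "Im z \<noteq> 0"
  have bound: "2 * Im z * t \<le> (norm x)\<^sup>2" for t
  proof -
    define w where "w = \<i> * complex_of_real t"
    have "z + w \<in> cstar_spectrum (x + w *\<^sub>C 1)"
      using z by (simp add: cstar_spectrum_add)
    then have 1: "(cmod (z + w))\<^sup>2 \<le> (norm (x + w *\<^sub>C 1))\<^sup>2"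
      by (intro power_mono cstar_spectrum_norm_le) simp_all
    have "adj (x + w *\<^sub>C 1) * (x + w *\<^sub>C 1) = x * x + (t\<^sup>2) *\<^sub>R 1"
      using sa by (simp add: cstar_selfadjoint_def adj_add adj_scaleC w_def mult_scaleC_left
          mult_scaleC_right scaleC_scaleC scaleC_add_right scaleC_diff_right algebra_simps
          power2_eq_square flip: scaleC_of_real)
    then have "(norm (x + w *\<^sub>C 1))\<^sup>2 = norm (x * x + (t\<^sup>2) *\<^sub>R 1)"
      using cstar_identity[of "x + w *\<^sub>C 1"] by simp
    also have "\<dots> \<le> norm (x * x) + norm ((t\<^sup>2) *\<^sub>R (1::'a))" by (rule norm_triangle_ineq)
    also have "\<dots> \<le> (norm x)\<^sup>2 + t\<^sup>2"
      using norm_mult_ineq[of x x] by (simp add: power2_eq_square)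
    finally have 2: "(norm (x + w *\<^sub>C 1))\<^sup>2 \<le> (norm x)\<^sup>2 + t\<^sup>2" .
    have "(cmod (z + w))\<^sup>2 = (Re z)\<^sup>2 + (Im z + t)\<^sup>2"
      by (simp add: cmod_power2 w_def)
    then have "(Re z)\<^sup>2 + (Im z)\<^sup>2 + 2 * Im z * t + t\<^sup>2 \<le> (norm x)\<^sup>2 + t\<^sup>2"
      using 1 2 by (simp add: power2_sum)
    moreover have "0 \<le> (Re z)\<^sup>2" "0 \<le> (Im z)\<^sup>2" by simp_all
    ultimately show ?thesis by linarith
  qed
  have "2 * Im z * (((norm x)\<^sup>2 + 1) / (2 * Im z)) \<le> (norm x)\<^sup>2" by (rule bound)
  then show False using nz by simp
qed

section \<open>Roots of unity, and the norm of a self-adjoint element as its spectral radius\<close>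

lemma sum_powers_root_of_unity:
  assumes "0 < N" "j < N"
  shows "(\<Sum>k<N. (cis (2 * pi / N) ^ k) ^ j) = (if j = 0 then of_nat N else 0)"
proof (cases "j = 0")
  case False
  define w where "w = cis (2 * pi / N) ^ j"
  have w: "w = cis (2 * pi * j / N)"
    unfolding w_def Complex.DeMoivre by (simp add: mult_ac)
  have "w \<noteq> 1"
  proof
    assume "w = 1"
    then have "cos (2 * pi * j / N) = 1"
      unfolding w by (metis cis.sel(1) one_complex.sel(1))
    then obtain n :: int where "2 * pi * j / N = of_int n * 2 * pi"
      using cos_one_2pi_int by blast
    then have "real j = of_int n * real N" using assms by (simp add: field_simps)
    then have "int j = n * int N" by (metis of_int_eq_iff of_int_mult of_int_of_nat_eq)
    then have "int N dvd int j" by simp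
    then show False using assms False by (auto dest: dvd_imp_le)
  qed
  moreover have "w ^ N = 1"
  proof -
    have "real N * (2 * pi * j / N) = 2 * pi * j" using assms by simp
    then show ?thesis by (simp only: w Complex.DeMoivre cis_multiple_2pi Ints_of_nat)
  qed
  ultimately have "(\<Sum>k<N. w ^ k) = 0"
    by (simp add: geometric_sum)
  then show ?thesis using False by (simp add: w_def mult.commute flip: power_mult)
qed simp

text \<open>Rickart's argument. With \<open>R z = (1 - z x)\<^sup>-\<^sup>1\<close>, the mean of \<open>R (\<rho> \<omega>)\<close> over the \<open>n\<close>-th roots of
  unity \<open>\<omega>\<close> is \<open>(1 - \<rho>\<^sup>n x\<^sup>n)\<^sup>-\<^sup>1\<close>. As \<open>R\<close> is Lipschitz on the closed unit disc, the means for
  \<open>\<rho> < 1\<close>, which tend to \<open>1\<close>, are close to the mean for \<open>\<rho> = 1\<close>, uniformly in \<open>n\<close>.\<close>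

lemma power_tendsto_zero_if_resolvents:
  fixes x :: "'a::cstar_algebra"
  assumes nx: "norm x \<le> 1"
    and inv: "\<And>z. cmod z \<le> 1 \<Longrightarrow> cstar_invertible (1 - z *\<^sub>C x)"
  shows "(\<lambda>n. x ^ n) \<longlonglongrightarrow> 0"
proof -
  obtain R where R: "(1 - z *\<^sub>C x) * R z = 1" "R z * (1 - z *\<^sub>C x) = 1" if "cmod z \<le> 1" for z
    using inv unfolding cstar_invertible_def by metis
  \<comment> \<open>The resolvent identity in norm form. It first yields boundedness of
    \<open>R\<close> on the disc and then, with that bound, the Lipschitz estimate.\<close>
  have R_diff: "norm (R z - R w) \<le> norm (R z) * norm (R w) * norm x * cmod (z - w)"
    if "cmod z \<le> 1" "cmod w \<le> 1" for z w
  proof -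
    have "R z - R w = R z * ((1 - w *\<^sub>C x) * R w) - (R z * (1 - z *\<^sub>C x)) * R w"
      using R that by simp
    also have "\<dots> = R z * ((z - w) *\<^sub>C x) * R w"
      by (simp only: scaleC_diff_left left_diff_distrib right_diff_distrib mult.assoc mult_1_left
          mult_1_right) simp
    finally have "norm (R z - R w) = norm (R z * ((z - w) *\<^sub>C x) * R w)"
      by (rule arg_cong)
    also have "\<dots> \<le> norm (R z) * norm ((z - w) *\<^sub>C x) * norm (R w)"
      by (rule order_trans[OF norm_mult_ineq mult_right_mono[OF norm_mult_ineq norm_ge_zero]])
    finally have "norm (R z - R w) \<le> norm (R z) * norm ((z - w) *\<^sub>C x) * norm (R w)" .
    then show ?thesis by (simp add: norm_scaleC mult_ac)
  qed
  \<comment> \<open>If \<open>R\<close> were unbounded, arguments of ever larger values would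
    accumulate at some \<open>w\<close> in the disc. Near \<open>w\<close>, however, the resolvent
    identity bounds \<open>norm (R z)\<close> by twice \<open>norm (R w)\<close>.\<close>
  have "\<exists>C. \<forall>z\<in>cball 0 1. norm (R z) \<le> C"
  proof (rule ccontr)
    assume "\<not> ?thesis"
    then have "\<forall>n::nat. \<exists>z\<in>cball 0 1. norm (R z) > real n" by (metis not_le)
    then obtain f where f: "\<And>n. f n \<in> cball 0 1" "\<And>n::nat. norm (R (f n)) > real n" by metis
    have "compact (cball (0::complex) 1)" by simp
    then obtain w r where w: "w \<in> cball 0 1" "strict_mono r" "(f \<circ> r) \<longlonglongrightarrow> w"
      using f(1) unfolding compact_def by metis
    \<comment> \<open>Within distance \<open>d\<close> of \<open>w\<close>, the difference
      \<open>R z - R w\<close> has norm at most half of \<open>norm (R z)\<close> and can be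
      absorbed. The summand 1 keeps the denominator positive.\<close>
    define d where "d = 1 / (2 * (norm (R w) * norm x + 1))"
    have d: "0 < d" "norm (R w) * norm x * d \<le> 1 / 2"
      using mult_nonneg_nonneg[OF norm_ge_zero norm_ge_zero, of "R w" x]
      by (simp_all add: d_def add_nonneg_pos divide_le_eq)
    have "\<forall>\<^sub>F n in sequentially. dist ((f \<circ> r) n) w < d"
      using w(3) d(1) by (rule tendstoD)
    moreover have "\<forall>\<^sub>F n in sequentially. 2 * norm (R w) < real n"
      using filterlim_real_sequentially by (auto simp: filterlim_at_top_dense)
    ultimately have "\<forall>\<^sub>F n in sequentially. False"
    proof eventually_elim
      case (elim n)
      define z where "z = f (r n)"
      have z: "cmod z \<le> 1" "cmod (z - w) \<le> d"
        using f(1)[of "r n"] elim(1) by (simp_all add: z_def dist_norm)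
      have "norm (R z) \<le> norm (R w) + norm (R z - R w)"
        by (metis add.commute norm_triangle_sub)
      also have "norm (R z - R w) \<le> norm (R z) * norm (R w) * norm x * cmod (z - w)"
        using z w(1) by (intro R_diff) simp_all
      also have "\<dots> \<le> norm (R z) * norm (R w) * norm x * d"
        using z by (intro mult_left_mono) simp_all
      also have "\<dots> \<le> norm (R z) * (1 / 2)"
        using mult_left_mono[OF d(2), of "norm (R z)"] by (simp add: mult_ac)
      finally have "norm (R z) \<le> 2 * norm (R w)" by simp
      moreover have "real n \<le> real (r n)" using w(2) by (simp add: seq_suble)
      moreover have "real (r n) < norm (R z)" unfolding z_def by (rule f(2))
      ultimately show ?case using elim(2) by linarith
    qed
    then show False by simp
  qed
  then obtain C where "\<forall>z\<in>cball 0 1. norm (R z) \<le> C" by blast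
  then have C: "norm (R z) \<le> C" if "cmod z \<le> 1" for z using that by simp
  have C0: "0 \<le> C" using order_trans[OF norm_ge_zero C[of 0]] by simp
  define L where "L = C * C * norm x"
  have L0: "0 \<le> L" by (simp add: L_def)
  have Lip: "norm (R z - R w) \<le> L * cmod (z - w)" if "cmod z \<le> 1" "cmod w \<le> 1" for z w
  proof -
    have "norm (R z) * norm (R w) \<le> C * C" using C that by (intro mult_mono) (auto simp: C0)
    then have "norm (R z) * norm (R w) * norm x * cmod (z - w) \<le> L * cmod (z - w)"
      unfolding L_def by (intro mult_right_mono) simp_all
    then show ?thesis using R_diff[OF that] by linarith
  qed
  have bound: "norm (x ^ n) \<le> 2 * (L * (1 - \<rho>) + \<rho> ^ n * C)" if \<rho>: "0 \<le> \<rho>" "\<rho> \<le> 1" and n: "0 < n" for \<rho> n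
  proof -
    define \<omega> where "\<omega> = cis (2 * pi / n)"
    have \<omega>n: "\<omega> ^ n = 1"
      using n by (simp add: \<omega>_def Complex.DeMoivre)
    have \<omega>1: "cmod (\<omega> ^ k) = 1" for k by (simp add: \<omega>_def norm_power)
    define A where "A r = (\<Sum>k<n. R (complex_of_real r * \<omega> ^ k)) /\<^sub>R real n" for r
    have A: "(1 - r ^ n *\<^sub>R x ^ n) * A r = 1" "norm (A r) \<le> C" if r: "0 \<le> r" "r \<le> 1" for r
    proof -
      have cm: "cmod (complex_of_real r * \<omega> ^ k) \<le> 1" for k
        using r \<omega>1 by (simp add: norm_mult)
      \<comment> \<open>All points \<open>complex_of_real r * \<omega> ^ k\<close> have the same
        \<open>n\<close>-th power \<open>r ^ n\<close>, so one common factor turns every resolvent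
        into a polynomial of degree below \<open>n\<close>. Summing over \<open>k\<close> then
        leaves only the constant term.\<close>
      have "(1 - r ^ n *\<^sub>R x ^ n) * R (complex_of_real r * \<omega> ^ k) =
          (\<Sum>i<n. (complex_of_real (r ^ i) * (\<omega> ^ k) ^ i) *\<^sub>C x ^ i)" for k
      proof -
        define z where "z = complex_of_real r * \<omega> ^ k"
        have "z ^ n = complex_of_real (r ^ n) * (\<omega> ^ n) ^ k"
          by (simp add: z_def power_mult_distrib mult.commute flip: power_mult)
        then have "r ^ n *\<^sub>R x ^ n = (z *\<^sub>C x) ^ n"
          by (simp add: scaleC_power \<omega>n flip: scaleC_of_real)
        then have "(1 - r ^ n *\<^sub>R x ^ n) * R z = (\<Sum>i<n. (z *\<^sub>C x) ^ i) * ((1 - z *\<^sub>C x) * R z)"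
          by (simp only: one_diff_power_noncomm mult.assoc)
        also have "(1 - z *\<^sub>C x) * R z = 1" using R(1) cm by (simp add: z_def)
        finally show ?thesis by (simp add: z_def scaleC_power power_mult_distrib)
      qed
      then have "(1 - r ^ n *\<^sub>R x ^ n) * (\<Sum>k<n. R (complex_of_real r * \<omega> ^ k)) =
          (\<Sum>k<n. \<Sum>i<n. (complex_of_real (r ^ i) * (\<omega> ^ k) ^ i) *\<^sub>C x ^ i)"
        by (simp add: sum_distrib_left)
      also have "\<dots> = (\<Sum>i<n. \<Sum>k<n. (complex_of_real (r ^ i) * (\<omega> ^ k) ^ i) *\<^sub>C x ^ i)"
        by (rule sum.swap)
      also have "\<dots> = (\<Sum>i<n. (complex_of_real (r ^ i) * (\<Sum>k<n. (\<omega> ^ k) ^ i)) *\<^sub>C x ^ i)"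
        by (simp add: sum_distrib_left scaleC_sum_left)
      also have "\<dots> = (\<Sum>i<n. if i = 0 then of_nat n *\<^sub>C 1 else 0)"
        using n by (intro sum.cong) (simp_all add: \<omega>_def sum_powers_root_of_unity)
      also have "\<dots> = real n *\<^sub>R 1"
        using n by (simp flip: scaleC_of_real)
      finally show "(1 - r ^ n *\<^sub>R x ^ n) * A r = 1" using n by (simp add: A_def)
      have "norm (\<Sum>k<n. R (complex_of_real r * \<omega> ^ k)) \<le> real n * C"
        using sum_norm_bound[of "{..<n}" "\<lambda>k. R (complex_of_real r * \<omega> ^ k)" C] C[OF cm] by simp
      then show "norm (A r) \<le> C" using n by (simp add: A_def field_simps)
    qed
    have "norm (\<Sum>k<n. R (\<omega> ^ k) - R (complex_of_real \<rho> * \<omega> ^ k)) \<le> real (card {..<n}) * (L * (1 - \<rho>))"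
    proof (rule sum_norm_bound)
      fix k
      have "\<omega> ^ k - complex_of_real \<rho> * \<omega> ^ k = complex_of_real (1 - \<rho>) * \<omega> ^ k"
        by (simp add: algebra_simps)
      then have "cmod (\<omega> ^ k - complex_of_real \<rho> * \<omega> ^ k) = 1 - \<rho>"
        using \<rho> \<omega>1 by (simp only: norm_mult norm_of_real) simp
      then show "norm (R (\<omega> ^ k) - R (complex_of_real \<rho> * \<omega> ^ k)) \<le> L * (1 - \<rho>)"
        using Lip[of "\<omega> ^ k" "complex_of_real \<rho> * \<omega> ^ k"] \<omega>1 \<rho> by (simp add: norm_mult)
    qed
    moreover have "A 1 - A \<rho> = (\<Sum>k<n. R (\<omega> ^ k) - R (complex_of_real \<rho> * \<omega> ^ k)) /\<^sub>R real n"
      by (simp add: A_def sum_subtractf scaleR_diff_right)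
    ultimately have 1: "norm (A 1 - A \<rho>) \<le> L * (1 - \<rho>)"
      using n by (simp add: field_simps)
    have xn: "norm (x ^ n) \<le> 1"
      using norm_power_ineq[of x n] power_le_one[OF norm_ge_zero nx, of n] by linarith
    have "A \<rho> - 1 = \<rho> ^ n *\<^sub>R (x ^ n * A \<rho>)"
      using A(1)[OF \<rho>] by (simp add: algebra_simps)
    then have "norm (A \<rho> - 1) = \<rho> ^ n * norm (x ^ n * A \<rho>)"
      using \<rho> by simp
    also have "norm (x ^ n * A \<rho>) \<le> 1 * C"
      using norm_mult_ineq[of "x ^ n" "A \<rho>"] mult_mono[OF xn A(2)[OF \<rho>]] by simp
    finally have 2: "norm (A \<rho> - 1) \<le> \<rho> ^ n * C"
      using \<rho> by (simp add: mult_left_mono)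
    have 3: "norm (A 1 - 1) \<le> L * (1 - \<rho>) + \<rho> ^ n * C"
      using norm_triangle_ineq[of "A 1 - A \<rho>" "A \<rho> - 1"] 1 2 by simp
    \<comment> \<open>As \<open>A 1\<close> is a right inverse of \<open>1 - x ^ n\<close>, the
      power \<open>x ^ n\<close> can be recovered from \<open>A 1 - 1\<close>. Since
      \<open>norm (x ^ n) \<le> 1\<close>, this costs the factor 2 in the bound.\<close>
    have "x ^ n = (A 1 - 1) - x ^ n * (A 1 - 1)"
      using A(1)[of 1] by (simp add: algebra_simps)
    then have "norm (x ^ n) \<le> norm (A 1 - 1) + norm (x ^ n * (A 1 - 1))"
      by (metis norm_triangle_ineq4)
    also have "norm (x ^ n * (A 1 - 1)) \<le> 1 * norm (A 1 - 1)"
      using norm_mult_ineq[of "x ^ n" "A 1 - 1"] mult_right_mono[OF xn, of "norm (A 1 - 1)"] by simp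
    finally show ?thesis using 3 by simp
  qed
  show ?thesis
  proof (rule metric_LIMSEQ_I)
    fix e :: real assume e: "0 < e"
    \<comment> \<open>This makes \<open>L * (1 - \<rho>)\<close> smaller than \<open>e / 4\<close>
      even if \<open>L = 0\<close>. Once \<open>\<rho> ^ n * C\<close> is below \<open>e / 4\<close>
      as well, the bound is below \<open>e\<close>; \<open>Suc N\<close> provides the hypothesis
      \<open>0 < n\<close>.\<close>
    define \<rho> where "\<rho> = 1 - e / (4 * (L + e))"
    have \<rho>: "0 \<le> \<rho>" "\<rho> < 1" "L * (1 - \<rho>) < e / 4"
      using e L0 by (simp_all add: \<rho>_def field_simps add_pos_nonneg)
    have "(\<lambda>n. \<rho> ^ n * C) \<longlonglongrightarrow> 0"
      using \<rho> by (intro tendsto_mult_left_zero LIMSEQ_realpow_zero)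
    then obtain N where N: "\<And>n. n \<ge> N \<Longrightarrow> \<bar>\<rho> ^ n * C\<bar> < e / 4"
      using LIMSEQ_D[of _ 0 "e / 4"] e by force
    have "dist (x ^ n) 0 < e" if "n \<ge> Suc N" for n
      using bound[of \<rho> n] N[of n] \<rho> that by fastforce
    then show "\<exists>N. \<forall>n\<ge>N. dist (x ^ n) 0 < e" by blast
  qed
qed

text \<open>For self-adjoint elements the C*-identity says that squaring an element squares its
  norm; repeated squaring reaches the exponents \<open>2 ^ j\<close>.\<close>

lemma cstar_selfadjoint_norm_power:
  fixes x :: "'a::cstar_algebra"
  assumes "cstar_selfadjoint x"
  shows "norm (x ^ 2 ^ j) = norm x ^ 2 ^ j"
proof (induction j)
  case (Suc j)
  have "x ^ 2 ^ Suc j = adj (x ^ 2 ^ j) * x ^ 2 ^ j"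
    using assms by (simp add: cstar_selfadjoint_def adj_power mult_2 flip: power_add)
  then show ?case
    by (simp add: cstar_identity Suc mult.commute flip: power_mult)
qed simp

text \<open>If \<open>norm x\<close> exceeded \<open>t\<close>, then for the normalized element
  \<open>m\<close> all \<open>1 - z *\<^sub>C m\<close> with \<open>z\<close> in the closed unit
  disc would be invertible. The powers of \<open>m\<close> would tend to 0, although those with
  exponents \<open>2 ^ j\<close> have norm 1.\<close>

lemma cstar_selfadjoint_norm_le:
  fixes x :: "'a::cstar_algebra"
  assumes sa: "cstar_selfadjoint x" and t: "0 \<le> t"
    and spec: "\<And>z. z \<in> cstar_spectrum x \<Longrightarrow> cmod z \<le> t"
  shows "norm x \<le> t"
proof (rule ccontr)
  define r where "r = norm x"
  assume "\<not> norm x \<le> t"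
  then have r: "r > t" "r > 0" using t by (auto simp: r_def)
  define m where "m = x /\<^sub>R r"
  have m: "norm m = 1" "cstar_selfadjoint m"
    using r sa by (simp_all add: m_def r_def cstar_selfadjoint_scaleR)
  have inv: "cstar_invertible (1 - z *\<^sub>C m)" if "cmod z \<le> 1" for z
  proof (cases "z = 0")
    case False
    have "r \<le> cmod (complex_of_real r / z)"
      using that False r by (simp add: norm_divide field_simps)
    then have "complex_of_real r / z \<notin> cstar_spectrum x"
      using spec r by fastforce
    moreover have "1 - z *\<^sub>C m = (z / complex_of_real r) *\<^sub>C ((complex_of_real r / z) *\<^sub>C 1 - x)"
      using False r by (simp add: m_def scaleC_diff_right scaleC_scaleC scaleC_scaleR field_simps)
    ultimately show ?thesis
      using False r by (simp add: cstar_spectrum_def cstar_invertible_scaleC_iff)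
  qed simp
  have "(\<lambda>n. m ^ n) \<longlonglongrightarrow> 0"
    using m inv by (intro power_tendsto_zero_if_resolvents) simp_all
  then obtain N where "\<And>n. n \<ge> N \<Longrightarrow> norm (m ^ n) < 1"
    using LIMSEQ_D[of _ 0 1] by force
  then have "norm (m ^ 2 ^ N) < 1" by (simp add: less_imp_le)
  then show False using m by (simp add: cstar_selfadjoint_norm_power)
qed

section \<open>Positive elements\<close>

text \<open>The spectrum is real, so only negative points must be excluded, and \<open>- r\<close>
  is a spectral point exactly when \<open>x + of_real r\<close> is not invertible. Most positivity
  claims below are checked by this criterion.\<close>

lemma cstar_positiveI:
  fixes x :: "'a::cstar_algebra"
  assumes sa: "cstar_selfadjoint x" and inv: "\<And>r. 0 < r \<Longrightarrow> cstar_invertible (x + of_real r)"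
  shows "cstar_positive x"
  unfolding cstar_positive_def
proof (intro conjI subsetI)
  fix z assume z: "z \<in> cstar_spectrum x"
  then have zr: "z = complex_of_real (Re z)"
    using cstar_selfadjoint_spectrum_real[OF sa] by (simp add: complex_eq_iff)
  have "0 \<le> Re z"
  proof (rule ccontr)
    assume "\<not> 0 \<le> Re z"
    then have "0 < - Re z" by simp
    from inv[OF this] have "cstar_invertible (- (x + of_real (- Re z)))"
      by (simp only: cstar_invertible_minus_iff)
    moreover have "- (x + of_real (- Re z)) = z *\<^sub>C 1 - x"
      by (subst zr) (simp add: scaleC_of_real_one)
    ultimately show False using z by (simp add: cstar_spectrum_def)
  qed
  then show "z \<in> complex_of_real ` {0..}" using zr by auto
qed (rule sa)

lemma cstar_positive_invertible_add:
  fixes x :: "'a::cstar_algebra"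
  assumes "cstar_positive x" "0 < r"
  shows "cstar_invertible (x + of_real r)"
proof (rule ccontr)
  assume "\<not> ?thesis"
  moreover have "complex_of_real (- r) *\<^sub>C 1 - x = - (x + of_real r)"
    by (simp only: scaleC_of_real_one) simp
  ultimately have "complex_of_real (- r) \<in> cstar_spectrum x"
    by (simp only: cstar_spectrum_def mem_Collect_eq cstar_invertible_minus_iff simp_thms)
  then have "complex_of_real (- r) \<in> complex_of_real ` {0..}"
    using assms(1) unfolding cstar_positive_def by blast
  then show False using assms(2) by (auto simp: of_real_eq_iff simp del: of_real_minus)
qed

lemma cstar_positive_selfadjoint: "cstar_positive x \<Longrightarrow> cstar_selfadjoint x"
  by (simp add: cstar_positive_def)

text \<open>The spectrum of \<open>x\<close> lies in the real interval from \<open>- t\<close> to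
  \<open>t\<close>. It avoids the negative half exactly when \<open>of_real t - x\<close> has
  spectral radius, hence norm, at most \<open>t\<close>. Unlike the spectral condition, the norm
  condition is easily added.\<close>

lemma cstar_positive_norm_iff:
  fixes x :: "'a::cstar_algebra"
  assumes sa: "cstar_selfadjoint x" and t: "norm x \<le> t"
  shows "cstar_positive x \<longleftrightarrow> norm (of_real t - x) \<le> t"
proof
  assume pos: "cstar_positive x"
  have t0: "0 \<le> t" using t norm_ge_zero order_trans by blast
  show "norm (of_real t - x) \<le> t"
  proof (rule cstar_selfadjoint_norm_le[OF cstar_selfadjoint_diff[OF cstar_selfadjoint_of_real sa] t0])
    fix z assume "z \<in> cstar_spectrum (of_real t - x)"
    then have z: "complex_of_real t - z \<in> cstar_spectrum x"
      by (simp only: cstar_spectrum_diff flip: scaleC_of_real_one)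
    then obtain s where s: "complex_of_real t - z = complex_of_real s" "0 \<le> s"
      using pos unfolding cstar_positive_def by auto
    moreover have "s \<le> norm x"
      using cstar_spectrum_norm_le[OF z] s by simp
    moreover have "z = complex_of_real (t - s)" using s by (simp add: algebra_simps)
    ultimately show "cmod z \<le> t" using t by (simp del: of_real_diff)
  qed
next
  assume le: "norm (of_real t - x) \<le> t"
  show "cstar_positive x"
    unfolding cstar_positive_def
  proof (intro conjI subsetI)
    fix z assume z: "z \<in> cstar_spectrum x"
    then have zr: "z = complex_of_real (Re z)"
      using cstar_selfadjoint_spectrum_real[OF sa] by (simp add: complex_eq_iff)
    have "complex_of_real t - z \<in> cstar_spectrum (of_real t - x)"
      using z by (simp add: cstar_spectrum_diff flip: scaleC_of_real_one)
    then have "cmod (complex_of_real t - z) \<le> t"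
      using cstar_spectrum_norm_le le order_trans by blast
    moreover have "t - Re z \<le> cmod (complex_of_real t - z)"
      using complex_Re_le_cmod[of "complex_of_real t - z"] by simp
    ultimately have "0 \<le> Re z" by linarith
    then show "z \<in> complex_of_real ` {0..}" using zr by auto
  qed (rule sa)
qed

section \<open>The convex cone of positive elements\<close>

text \<open>The norm criteria for \<open>x\<close> with bound \<open>norm x\<close> and for
  \<open>y\<close> with bound \<open>norm y\<close> add up by the triangle inequality.\<close>

lemma cstar_positive_add:
  fixes x y :: "'a::cstar_algebra"
  assumes "cstar_positive x" "cstar_positive y"
  shows "cstar_positive (x + y)"
proof -
  have "norm (of_real (norm x) - x) \<le> norm x" "norm (of_real (norm y) - y) \<le> norm y"
    using assms cstar_positive_norm_iff cstar_positive_selfadjoint by blast+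
  then have "norm (of_real (norm x + norm y) - (x + y)) \<le> norm x + norm y"
    using norm_triangle_ineq[of "of_real (norm x) - x" "of_real (norm y) - y"]
    by (simp add: algebra_simps)
  then show ?thesis
    using assms norm_triangle_ineq
    by (subst cstar_positive_norm_iff[where t = "norm x + norm y"]) (blast intro: cstar_selfadjoint_add cstar_positive_selfadjoint)+
qed

lemma cstar_positive_of_real [simp]:
  assumes "0 \<le> r"
  shows "cstar_positive (of_real r :: 'a::cstar_algebra)"
proof (rule cstar_positiveI)
  fix s :: real assume "0 < s"
  then have "r + s \<noteq> 0" using assms by simp
  then have "cstar_invertible (complex_of_real (r + s) *\<^sub>C (1::'a))"
    by (simp only: cstar_invertible_scaleC_iff of_real_eq_0_iff simp_thms cstar_invertible_one)
  then have "cstar_invertible (of_real (r + s) :: 'a)"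
    by (simp only: scaleC_of_real_one)
  then show "cstar_invertible (of_real r + of_real s :: 'a)" by simp
qed simp

lemma cstar_positive_scaleR:
  fixes x :: "'a::cstar_algebra"
  assumes pos: "cstar_positive x" and r: "0 \<le> r"
  shows "cstar_positive (r *\<^sub>R x)"
proof (cases "r = 0")
  case True
  then show ?thesis using cstar_positive_of_real[of 0] by simp
next
  case False
  show ?thesis
  proof (rule cstar_positiveI)
    show "cstar_selfadjoint (r *\<^sub>R x)"
      using pos by (intro cstar_selfadjoint_scaleR cstar_positive_selfadjoint)
    fix s :: real assume s: "0 < s"
    have "r *\<^sub>R x + of_real s = complex_of_real r *\<^sub>C (x + of_real (s / r))"
      using False by (simp add: scaleC_of_real scaleR_add_right) (simp add: of_real_def)
    moreover have "cstar_invertible (x + of_real (s / r))"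
      using pos r False s by (intro cstar_positive_invertible_add) simp_all
    ultimately show "cstar_invertible (r *\<^sub>R x + of_real s)"
      using False by (simp add: cstar_invertible_scaleC_iff)
  qed
qed

lemma cstar_positive_sum:
  fixes f :: "'i \<Rightarrow> 'a::cstar_algebra"
  assumes "\<And>i. i \<in> I \<Longrightarrow> cstar_positive (f i)"
  shows "cstar_positive (\<Sum>i\<in>I. f i)"
  using assms cstar_positive_of_real[of 0, where 'a = 'a]
  by (induction I rule: infinite_finite_induct) (simp_all add: cstar_positive_add)

text \<open>One half of \<open>r\<close> makes \<open>x\<close> positive, the other half then makes
  it invertible. This is the form in which limits of positive elements are taken below.\<close>

lemma cstar_positive_approx:
  fixes x :: "'a::cstar_algebra"
  assumes "cstar_selfadjoint x" "\<And>e. 0 < e \<Longrightarrow> cstar_positive (x + of_real e)"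
  shows "cstar_positive x"
proof (rule cstar_positiveI)
  fix r :: real assume "0 < r"
  then have "cstar_invertible (x + of_real (r / 2) + of_real (r / 2))"
    using assms(2) by (intro cstar_positive_invertible_add) simp_all
  then show "cstar_invertible (x + of_real r)"
    by (simp only: add.assoc field_sum_of_halves flip: of_real_add)
qed (rule assms)

text \<open>No \<open>- (t + r)\<close> with \<open>0 < r\<close> can be a spectral point, its
  modulus being larger than \<open>norm x\<close>. The lemma serves to absorb error terms of norm at
  most \<open>t\<close>.\<close>

lemma cstar_positive_norm_add:
  fixes x :: "'a::cstar_algebra"
  assumes "cstar_selfadjoint x" "norm x \<le> t"
  shows "cstar_positive (x + of_real t)"
proof (rule cstar_positiveI)
  show "cstar_selfadjoint (x + of_real t)"
    using assms by (intro cstar_selfadjoint_add) simp_all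
  fix r :: real assume "0 < r"
  then have "norm x < cmod (complex_of_real (- (t + r)))"
    unfolding norm_of_real using assms(2) by linarith
  then have "complex_of_real (- (t + r)) \<notin> cstar_spectrum x"
    using cstar_spectrum_norm_le leD by blast
  then have "cstar_invertible (of_real (- (t + r)) - x)"
    by (simp only: cstar_spectrum_def mem_Collect_eq scaleC_of_real_one simp_thms)
  moreover have "of_real (- (t + r)) - x = - (x + of_real t + of_real r)" by simp
  ultimately show "cstar_invertible (x + of_real t + of_real r)"
    by (simp only: cstar_invertible_minus_iff)
qed

text \<open>Spectral points are both nonnegative and nonpositive, so the spectral radius, and with
  it the norm, is 0.\<close>

lemma cstar_positive_antisym:
  fixes x :: "'a::cstar_algebra"
  assumes "cstar_positive x" "cstar_positive (- x)"
  shows "x = 0"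
proof -
  have "norm x \<le> 0"
  proof (rule cstar_selfadjoint_norm_le)
    fix z assume z: "z \<in> cstar_spectrum x"
    then have "- z \<in> cstar_spectrum (- x)"
      using cstar_spectrum_diff[of "- z" 0 x] by simp
    then have "- z \<in> complex_of_real ` {0..}" "z \<in> complex_of_real ` {0..}"
      using z assms unfolding cstar_positive_def by blast+
    then show "cmod z \<le> 0" by (auto simp: complex_eq_iff)
  qed (use assms in \<open>simp_all add: cstar_positive_def\<close>)
  then show ?thesis by simp
qed

text \<open>Over the complex scalars \<open>x\<^sup>2 + of_real r\<close> splits into two factors
  with purely imaginary shifts of \<open>x\<close>; these are invertible because the spectrum of
  \<open>x\<close> is real.\<close>

lemma cstar_positive_square:
  fixes x :: "'a::cstar_algebra"
  assumes sa: "cstar_selfadjoint x"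
  shows "cstar_positive (x\<^sup>2)"
proof (rule cstar_positiveI)
  fix r :: real assume r: "0 < r"
  define w where "w = \<i> * complex_of_real (sqrt r)"
  have "Im w \<noteq> 0" "Im (- w) \<noteq> 0" using r by (simp_all add: w_def)
  then have "w \<notin> cstar_spectrum x" "- w \<notin> cstar_spectrum x"
    using cstar_selfadjoint_spectrum_real[OF sa] by blast+
  then have "cstar_invertible ((w *\<^sub>C 1 - x) * ((- w) *\<^sub>C 1 - x))"
    by (simp add: cstar_spectrum_def cstar_invertible_mult del: scaleC_minus_left)
  moreover have "w *\<^sub>C (w *\<^sub>C (1::'a)) = - of_real r"
  proof -
    have "w * w = complex_of_real (- r)"
      using r by (simp add: w_def complex_eq_iff)
    then have "w *\<^sub>C (w *\<^sub>C (1::'a)) = of_real (- r)"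
      by (simp only: scaleC_scaleC scaleC_of_real_one)
    then show ?thesis by simp
  qed
  then have "(w *\<^sub>C 1 - x) * ((- w) *\<^sub>C 1 - x) = x\<^sup>2 + of_real r"
    by (simp add: left_diff_distrib right_diff_distrib mult_scaleC_left mult_scaleC_right
        scaleC_diff_right power2_eq_square)
  ultimately show "cstar_invertible (x\<^sup>2 + of_real r)" by simp
qed (rule cstar_selfadjoint_power[OF sa])

section \<open>Invertible positive elements and their products\<close>

text \<open>With \<open>b\<close> inverse to \<open>d\<close>, the element
  \<open>d - of_real t\<close> equals \<open>d * (1 - t *\<^sub>R b)\<close>. By the Neumann series
  it is invertible for small \<open>t\<close>, so the spectrum of \<open>d\<close> keeps a distance
  from 0.\<close>

lemma cstar_positive_invertible_lower_bound:
  fixes d :: "'a::cstar_algebra"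
  assumes pos: "cstar_positive d" and inv: "cstar_invertible d"
  obtains e where "0 < e" "cstar_positive (d - of_real e)"
proof -
  obtain b where b: "d * b = 1" "b * d = 1" using inv by (auto simp: cstar_invertible_def)
  define e where "e = 1 / (norm b + 1)"
  have nb: "0 < norm b + 1" by (simp add: add_nonneg_pos)
  then have e: "0 < e" "e * norm b < 1" by (simp_all add: e_def)
  have "cstar_positive (d - of_real e)"
  proof (rule cstar_positiveI)
    show "cstar_selfadjoint (d - of_real e)"
      using pos e by (intro cstar_selfadjoint_diff cstar_positive_selfadjoint) simp_all
    fix r :: real assume r: "0 < r"
    show "cstar_invertible (d - of_real e + of_real r)"
    proof (cases "r \<le> e")
      case True
      define t where "t = e - r"
      have "t * norm b \<le> e * norm b" using r by (intro mult_right_mono) (simp_all add: t_def)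
      then have "norm (t *\<^sub>R b) < 1" using True e by (simp add: t_def)
      then have "cstar_invertible (d * (1 - t *\<^sub>R b))"
        using inv by (intro cstar_invertible_mult cstar_invertible_one_diff)
      moreover have "d * (1 - t *\<^sub>R b) = d - of_real e + of_real r"
        using b by (simp add: right_diff_distrib t_def of_real_def scaleR_diff_left)
      ultimately show ?thesis by simp
    next
      case False
      then have "cstar_invertible (d + of_real (r - e))"
        using pos by (intro cstar_positive_invertible_add) simp_all
      then show ?thesis by (simp add: algebra_simps)
    qed
  qed
  then show ?thesis using e that by blast
qed

text \<open>A positive scalar \<open>e\<close> splits off from \<open>d\<close>; what remains is
  still positive together with \<open>p\<close>, and adding \<open>e\<close> back makes the sum
  invertible.\<close>

lemma cstar_invertible_positive_add:
  fixes p d :: "'a::cstar_algebra"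
  assumes "cstar_positive p" "cstar_positive d" "cstar_invertible d"
  shows "cstar_invertible (p + d)"
proof -
  obtain e where e: "0 < e" "cstar_positive (d - of_real e)"
    using cstar_positive_invertible_lower_bound assms(2,3) by blast
  then have "cstar_invertible (p + (d - of_real e) + of_real e)"
    using assms(1) by (intro cstar_positive_invertible_add cstar_positive_add)
  then show ?thesis by simp
qed

lemma cstar_invertible_scaleR:
  "r \<noteq> 0 \<Longrightarrow> cstar_invertible x \<Longrightarrow> cstar_invertible (r *\<^sub>R (x::'a::cstar_algebra))"
  using cstar_invertible_scaleC_iff[of "complex_of_real r" x] by (simp add: scaleC_of_real)

text \<open>Since \<open>c\<^sup>* p c + \<lambda> = c\<^sup>* (p + \<lambda> d) c\<close>, no square root of \<open>p\<close> is needed.\<close>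

lemma cstar_positive_conjugate:
  fixes p c d :: "'a::cstar_algebra"
  assumes p: "cstar_positive p" and d: "cstar_positive d" "cstar_invertible d"
    and c: "cstar_invertible c" "cstar_invertible (adj c)" "adj c * d * c = 1"
  shows "cstar_positive (adj c * p * c)"
proof (rule cstar_positiveI)
  show "cstar_selfadjoint (adj c * p * c)"
    using p by (simp add: cstar_positive_def cstar_selfadjoint_def adj_mult adj_adj mult.assoc)
  fix r :: real assume r: "0 < r"
  have "cstar_invertible (adj c * (p + r *\<^sub>R d) * c)"
    using assms r by (intro cstar_invertible_mult cstar_invertible_positive_add
        cstar_positive_scaleR cstar_invertible_scaleR) simp_all
  moreover have "adj c * (p + r *\<^sub>R d) * c = adj c * p * c + r *\<^sub>R (adj c * d * c)"
    by (simp add: algebra_simps)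
  ultimately show "cstar_invertible (adj c * p * c + of_real r)"
    by (simp add: c(3) of_real_def)
qed

text \<open>Self-adjointness follows from uniqueness of inverses, and \<open>b + of_real r\<close>
  is a multiple of \<open>b * (a + of_real (1 / r))\<close>.\<close>

lemma cstar_positive_inverse:
  fixes a b :: "'a::cstar_algebra"
  assumes pos: "cstar_positive a" and b: "a * b = 1" "b * a = 1"
  shows "cstar_positive b"
proof (rule cstar_positiveI)
  have "adj a = a" using pos by (simp add: cstar_positive_def cstar_selfadjoint_def)
  then have "adj b * a = 1" using b adj_mult[of a b] by simp
  then have "adj b = b" using b by (metis mult.assoc mult_1 mult_1_right)
  then show "cstar_selfadjoint b" by (simp add: cstar_selfadjoint_def)
  fix r :: real assume r: "0 < r"
  have "cstar_invertible (r *\<^sub>R (b * (a + of_real (1 / r))))"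
    using r pos b by (intro cstar_invertible_scaleR cstar_invertible_mult
        cstar_positive_invertible_add) (auto simp: cstar_invertible_def)
  moreover have "r *\<^sub>R (b * (a + of_real (1 / r))) = b + of_real r"
    using r b by (simp add: distrib_left scaleR_add_right) (simp add: of_real_def)
  ultimately show "cstar_invertible (b + of_real r)" by simp
qed

text \<open>Centrality makes the product self-adjoint. With \<open>b\<close> inverse to
  \<open>a\<close>, the shifted product is \<open>a * (y + r *\<^sub>R b)\<close>, whose second
  factor is positive plus positive invertible.\<close>

lemma cstar_positive_mult_central:
  fixes a y :: "'a::cstar_algebra"
  assumes a: "cstar_positive a" "cstar_invertible a" "cstar_central a" and y: "cstar_positive y"
  shows "cstar_positive (a * y)"
proof (rule cstar_positiveI)
  show "cstar_selfadjoint (a * y)"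
    using a y by (simp add: cstar_positive_def cstar_selfadjoint_def adj_mult cstar_central_def)
  fix r :: real assume r: "0 < r"
  obtain b where b: "a * b = 1" "b * a = 1" using a by (auto simp: cstar_invertible_def)
  then have "cstar_invertible b" by (auto simp: cstar_invertible_def)
  then have "cstar_invertible (a * (y + r *\<^sub>R b))"
    using a y r cstar_positive_inverse[OF a(1) b]
    by (intro cstar_invertible_mult cstar_invertible_positive_add
        cstar_positive_scaleR cstar_invertible_scaleR) simp_all
  moreover have "a * (y + r *\<^sub>R b) = a * y + of_real r"
    using b by (simp add: distrib_left of_real_def)
  ultimately show "cstar_invertible (a * y + of_real r)" by simp
qed

section \<open>Entire functions with positive real part\<close>

text \<open>The Herglotz--Caratheodory coefficient estimate: average the positive values against the
  nonnegative weights \<open>1 - Re (cnj u \<omega>)\<close> over the roots of unity \<open>\<omega>\<close>. Only the coefficients of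
  index \<open>0\<close> and \<open>1\<close> survive.\<close>

lemma cstar_positive_polynomial_coeff:
  fixes c :: "nat \<Rightarrow> 'a::cstar_algebra" and M :: nat
  defines "P \<equiv> \<lambda>z. \<Sum>n<M. z ^ n *\<^sub>C c n"
  assumes M: "2 \<le> M" and u: "cmod u = 1"
    and r: "0 \<le> r" and pos: "\<And>z. cmod z = r \<Longrightarrow> cstar_positive (P z + adj (P z) + of_real e)"
  shows "cstar_positive (c 0 + adj (c 0) - (r / 2) *\<^sub>R (u *\<^sub>C c 1 + adj (u *\<^sub>C c 1)) + of_real e)"
proof -
  \<comment> \<open>The weights raise an exponent \<open>n < M\<close> to \<open>Suc n\<close>,
    which must stay strictly below the number of roots for its sum to vanish; hence one root more
    than \<open>M\<close>.\<close>
  define N where "N = Suc M"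
  have N: "0 < N" "real N \<noteq> 0" by (simp_all add: N_def)
  define \<omega> where "\<omega> k = cis (2 * pi / N) ^ k" for k
  have \<omega>_sum: "(\<Sum>k<N. \<omega> k ^ n) = (if n = 0 then of_nat N else 0)" if "n < N" for n
    unfolding \<omega>_def using N(1) that by (rule sum_powers_root_of_unity)
  have \<omega>1: "cmod (\<omega> k) = 1" for k by (simp add: \<omega>_def norm_power)
  define l where "l k = 1 - Re (cnj u * \<omega> k)" for k
  have l0: "0 \<le> l k" for k
    using complex_Re_le_cmod[of "cnj u * \<omega> k"] u \<omega>1 by (simp add: l_def norm_mult)
  \<comment> \<open>In this form the weighted sum of \<open>\<omega> k ^ n\<close> splits into plain
    power sums whose exponents are shifted by at most one.\<close>
  have l: "complex_of_real (l k) = 1 - (cnj u * \<omega> k + u * cnj (\<omega> k)) / 2" for k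
    by (simp add: l_def complex_eq_iff field_simps)
  have coeff: "(\<Sum>k<N. complex_of_real (l k) * \<omega> k ^ n) =
      (if n = 0 then of_nat N else if n = 1 then - (u / 2) * of_nat N else 0)" if "n < M" for n
  proof -
    have cnj_sum: "(\<Sum>k<N. cnj (\<omega> k) * \<omega> k ^ n) = (if n = 1 then of_nat N else 0)"
    proof (cases n)
      case 0
      have "(\<Sum>k<N. cnj (\<omega> k)) = cnj (\<Sum>k<N. \<omega> k ^ 1)" by simp
      also have "\<dots> = 0" using M by (subst \<omega>_sum) (simp_all add: N_def)
      finally show ?thesis using 0 by simp
    next
      case (Suc m)
      have "cnj (\<omega> k) * \<omega> k = 1" for k
        using \<omega>1[of k] complex_norm_square[of "\<omega> k"] by (simp add: mult.commute)
      then have "cnj (\<omega> k) * \<omega> k ^ n = \<omega> k ^ m" for k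
        by (simp add: Suc flip: mult.assoc)
      then have "(\<Sum>k<N. cnj (\<omega> k) * \<omega> k ^ n) = (\<Sum>k<N. \<omega> k ^ m)" by (simp only:)
      also have "\<dots> = (if m = 0 then of_nat N else 0)"
        using that Suc by (intro \<omega>_sum) (simp add: N_def)
      finally show ?thesis using Suc by simp
    qed
    have "complex_of_real (l k) * \<omega> k ^ n =
        \<omega> k ^ n - cnj u / 2 * \<omega> k ^ Suc n - u / 2 * (cnj (\<omega> k) * \<omega> k ^ n)" for k
      unfolding l by (simp add: field_simps)
    then have "(\<Sum>k<N. complex_of_real (l k) * \<omega> k ^ n) = (\<Sum>k<N. \<omega> k ^ n) -
        cnj u / 2 * (\<Sum>k<N. \<omega> k ^ Suc n) - u / 2 * (\<Sum>k<N. cnj (\<omega> k) * \<omega> k ^ n)"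
      by (simp only: sum_subtractf sum_distrib_left)
    moreover have "(\<Sum>k<N. \<omega> k ^ Suc n) = 0"
      using that by (subst \<omega>_sum) (simp_all add: N_def)
    moreover have "(\<Sum>k<N. \<omega> k ^ n) = (if n = 0 then of_nat N else 0)"
      using that by (subst \<omega>_sum) (simp_all add: N_def)
    ultimately show ?thesis unfolding cnj_sum by simp
  qed
  define S where "S = (\<Sum>k<N. l k *\<^sub>R P (complex_of_real r * \<omega> k))"
  have "S = (\<Sum>k<N. \<Sum>n<M. (complex_of_real (r ^ n) * (complex_of_real (l k) * \<omega> k ^ n)) *\<^sub>C c n)"
    unfolding S_def P_def
    by (simp add: scaleR_sum_right scaleR_scaleC power_mult_distrib mult_ac)
  also have "\<dots> = (\<Sum>n<M. \<Sum>k<N. (complex_of_real (r ^ n) * (complex_of_real (l k) * \<omega> k ^ n)) *\<^sub>C c n)"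
    by (rule sum.swap)
  also have "\<dots> = (\<Sum>n<M. (complex_of_real (r ^ n) * (\<Sum>k<N. complex_of_real (l k) * \<omega> k ^ n)) *\<^sub>C c n)"
    by (simp only: sum_distrib_left scaleC_sum_left)
  also have "\<dots> = (\<Sum>n<M. if n \<in> {0, 1} then
      (complex_of_real (r ^ n) * (if n = 0 then of_nat N else - (u / 2) * of_nat N)) *\<^sub>C c n else 0)"
    by (intro sum.cong refl) (auto simp: coeff)
  also have "\<dots> = (\<Sum>n\<in>{0, 1}.
      (complex_of_real (r ^ n) * (if n = 0 then of_nat N else - (u / 2) * of_nat N)) *\<^sub>C c n)"
    using M by (intro sum.mono_neutral_cong_right) auto
  also have "\<dots> = complex_of_real (real N) *\<^sub>C c 0 - (complex_of_real (real N * (r / 2)) * u) *\<^sub>C c 1"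
    by (simp add: mult_ac)
  also have "\<dots> = real N *\<^sub>R (c 0 - (r / 2) *\<^sub>R (u *\<^sub>C c 1))"
    by (simp only: scaleC_of_real scaleR_diff_right scaleR_scaleR flip: scaleC_scaleC)
  finally have S: "S = real N *\<^sub>R (c 0 - (r / 2) *\<^sub>R (u *\<^sub>C c 1))" .
  \<comment> \<open>The weights have total \<open>N\<close>, so the averaging leaves the constant
    \<open>e\<close> unchanged.\<close>
  have "complex_of_real (\<Sum>k<N. l k) = complex_of_real (real N)"
    using coeff[of 0] M by simp
  then have lN: "(\<Sum>k<N. l k) = real N" by (simp only: of_real_eq_iff)
  have "cstar_positive (\<Sum>k<N. l k *\<^sub>R (P (complex_of_real r * \<omega> k) +
      adj (P (complex_of_real r * \<omega> k)) + of_real e))"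
    using r \<omega>1 l0 by (intro cstar_positive_sum cstar_positive_scaleR pos) (simp_all add: norm_mult)
  also have "(\<Sum>k<N. l k *\<^sub>R (P (complex_of_real r * \<omega> k) +
      adj (P (complex_of_real r * \<omega> k)) + of_real e)) = S + adj S + (\<Sum>k<N. l k) *\<^sub>R of_real e"
    by (simp add: S_def scaleR_add_right sum.distrib adj_sum adj_scaleR scaleR_sum_left)
  finally have "cstar_positive ((1 / real N) *\<^sub>R (S + adj S + (\<Sum>k<N. l k) *\<^sub>R of_real e))"
    by (intro cstar_positive_scaleR) simp_all
  also have "(1 / real N) *\<^sub>R (S + adj S + (\<Sum>k<N. l k) *\<^sub>R of_real e) =
      c 0 + adj (c 0) - (r / 2) *\<^sub>R (u *\<^sub>C c 1 + adj (u *\<^sub>C c 1)) + of_real e"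
    unfolding S lN using N(2)
    by (simp add: adj_scaleR adj_diff scaleR_add_right scaleR_diff_right)
  finally show ?thesis .
qed

text \<open>A Liouville theorem: the coefficient estimate, applied to truncations of the series,
  holds on every circle. Dividing by \<open>r / 2\<close> and letting \<open>r\<close> grow leaves
  \<open>- h u\<close> positive for all unimodular \<open>u\<close>. Passing to \<open>- u\<close>
  forces \<open>h u = 0\<close>, and two values of \<open>u\<close> determine
  \<open>c 1\<close>.\<close>

lemma cstar_positive_entire_coeff_zero:
  fixes c :: "nat \<Rightarrow> 'a::cstar_algebra"
  defines "g \<equiv> \<lambda>z. \<Sum>n. z ^ n *\<^sub>C c n"
  assumes summ: "\<And>r. 0 \<le> r \<Longrightarrow> summable (\<lambda>n. norm (c n) * r ^ n)"
    and pos: "\<And>z. cstar_positive (g z + adj (g z))"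
  shows "c 1 = 0"
proof -
  define h where "h u = u *\<^sub>C c 1 + adj (u *\<^sub>C c 1)" for u
  define T where "T r u = c 0 + adj (c 0) - (r / 2) *\<^sub>R h u" for r u
  have T_sa: "cstar_selfadjoint (T r u)" for r u
    by (simp add: T_def h_def cstar_selfadjoint_def adj_add adj_diff adj_scaleR adj_adj add.commute)
  have T_pos: "cstar_positive (T r u)" if r: "0 \<le> r" and u: "cmod u = 1" for r u
  proof (rule cstar_positive_approx[OF T_sa])
    fix e :: real assume e: "0 < e"
    \<comment> \<open>The tail enters twice, once directly and once through its adjoint, hence
      \<open>e / 2\<close>.\<close>
    obtain M0 where M0: "\<And>n. n \<ge> M0 \<Longrightarrow> norm (\<Sum>i. norm (c (i + n)) * r ^ (i + n)) < e / 2"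
      using suminf_exist_split[OF _ summ[OF r], of "e / 2"] e by auto
    \<comment> \<open>The maximum with 2 keeps the coefficient \<open>c 1\<close> in the
      truncation.\<close>
    define M where "M = max 2 M0"
    define P where "P z = (\<Sum>n<M. z ^ n *\<^sub>C c n)" for z
    have P_pos: "cstar_positive (P z + adj (P z) + of_real e)" if z: "cmod z = r" for z
    proof -
      have nrm: "norm (z ^ n *\<^sub>C c n) = norm (c n) * r ^ n" for n
        by (simp add: norm_scaleC norm_power z)
      have sm: "summable (\<lambda>n. z ^ n *\<^sub>C c n)"
        by (rule summable_norm_cancel) (simp add: nrm summ r)
      have "g z - P z = (\<Sum>i. z ^ (i + M) *\<^sub>C c (i + M))"
        unfolding g_def P_def by (rule suminf_minus_initial_segment[OF sm, symmetric])
      also have "norm \<dots> \<le> (\<Sum>i. norm (z ^ (i + M) *\<^sub>C c (i + M)))"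
      proof (rule summable_norm)
        have "summable (\<lambda>i. norm (c (i + M)) * r ^ (i + M))"
          by (rule summable_ignore_initial_segment[OF summ[OF r]])
        then show "summable (\<lambda>i. norm (z ^ (i + M) *\<^sub>C c (i + M)))" by (simp only: nrm)
      qed
      also have "\<dots> \<le> e / 2"
        using M0[of M] by (simp add: nrm M_def)
      finally have d: "norm (P z - g z) \<le> e / 2" by (simp add: norm_minus_commute)
      define q where "q = (P z - g z) + adj (P z - g z)"
      have "norm q \<le> norm (P z - g z) + norm (adj (P z - g z))"
        unfolding q_def by (rule norm_triangle_ineq)
      then have "norm q \<le> e" using d by simp
      moreover have "cstar_selfadjoint q"
        by (simp add: q_def cstar_selfadjoint_def adj_add adj_adj add.commute)
      ultimately have "cstar_positive (q + of_real e)" by (intro cstar_positive_norm_add)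
      then have "cstar_positive (g z + adj (g z) + (q + of_real e))"
        by (rule cstar_positive_add[OF pos])
      moreover have "g z + adj (g z) + (q + of_real e) = P z + adj (P z) + of_real e"
        by (simp add: q_def adj_diff)
      ultimately show ?thesis by simp
    qed
    have "2 \<le> M" by (simp add: M_def)
    from cstar_positive_polynomial_coeff[OF this u r P_pos[unfolded P_def]]
    show "cstar_positive (T r u + of_real e)"
      by (simp add: T_def h_def)
  qed
  have h_neg: "cstar_positive (- h u)" if u: "cmod u = 1" for u
  proof (rule cstar_positive_approx)
    have "adj (h u) = h u" by (simp add: h_def adj_add adj_adj add.commute)
    then show "cstar_selfadjoint (- h u)" by (simp add: cstar_selfadjoint_def)
    fix e :: real assume e: "0 < e"
    define x where "x = c 0 + adj (c 0)"
    define K where "K = norm x + 1"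
    have K: "0 < K" "norm (- x) \<le> K" by (simp_all add: K_def add_nonneg_pos)
    \<comment> \<open>With this radius the bound \<open>K\<close> for the constant term becomes
      exactly \<open>e\<close> after multiplication by \<open>2 / r\<close>.\<close>
    define r where "r = 2 * K / e"
    have r: "0 < r" using K e by (simp add: r_def)
    have "cstar_positive (- x + of_real K)"
      using K by (intro cstar_positive_norm_add)
        (simp_all add: x_def cstar_selfadjoint_def adj_add adj_adj adj_diff add.commute)
    then have "cstar_positive ((2 / r) *\<^sub>R (T r u + (- x + of_real K)))"
      using u r by (intro cstar_positive_scaleR cstar_positive_add[OF T_pos]) simp_all
    moreover have "(2 / r) *\<^sub>R (T r u + (- x + of_real K)) = - h u + (2 / r * K) *\<^sub>R 1"
      using r by (simp add: T_def x_def of_real_def algebra_simps)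
    moreover have "2 / r * K = e" using K e by (simp add: r_def)
    ultimately show "cstar_positive (- h u + of_real e)" by (simp add: of_real_def)
  qed
  have h_zero: "h u = 0" if "cmod u = 1" for u
  proof (rule cstar_positive_antisym)
    have "- h (- u) = h u" by (simp add: h_def)
    then show "cstar_positive (h u)" using h_neg[of "- u"] that by simp
  qed (rule h_neg[OF that])
  \<comment> \<open>The value \<open>u = 1\<close> makes \<open>c 1\<close> skew-adjoint and
    \<open>u = \<i>\<close> makes it self-adjoint, so it vanishes.\<close>
  have "adj (c 1) = - c 1"
    using h_zero[of 1] by (simp add: h_def add_eq_0_iff)
  then have "\<i> *\<^sub>C c 1 + \<i> *\<^sub>C c 1 = 0"
    using h_zero[of \<i>] by (simp add: h_def adj_scaleC)
  then have "(2 * \<i>) *\<^sub>C c 1 = 0"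
    by (simp only: scaleC_add_left mult_2)
  then have "norm ((2 * \<i>) *\<^sub>C c 1) = 0" by simp
  then show ?thesis by (simp add: norm_scaleC norm_mult)
qed

section \<open>Positivity of the Jordan product and centrality\<close>

text \<open>The entire function \<open>E z * (a * E (- z))\<close> conjugates \<open>a\<close> by
  the exponential of \<open>z *\<^sub>C b\<close>. The Jordan hypothesis makes its sum with its
  adjoint positive, so the linear coefficient vanishes.\<close>

lemma commute_selfadjoint_if_jordan_positive:
  fixes a b :: "'a::cstar_algebra"
  assumes a: "cstar_selfadjoint a" and b: "cstar_selfadjoint b"
    and jordan: "\<And>y. cstar_positive y \<Longrightarrow> cstar_positive (a * y + y * a)"
  shows "a * b = b * a"
proof -
  define E where "E z = exp (z *\<^sub>C b)" for z
  have E_add: "E z * E w = E (z + w)" for z w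
    unfolding E_def scaleC_add_left
    by (rule exp_add_commuting[symmetric])
      (simp add: mult_scaleC_left mult_scaleC_right scaleC_scaleC mult.commute)
  have E_zero: "E 0 = 1" by (simp add: E_def)
  have E_inv: "cstar_invertible (E z)" for z
    by (rule cstar_invertibleI[of "E (- z)" _ "E (- z)"]) (simp_all add: E_add E_zero)
  have E_adj: "adj (E z) = E (cnj z)" for z
    using b by (simp add: E_def adj_exp adj_scaleC cstar_selfadjoint_def)
  have E_pos: "cstar_positive (E (z + cnj z))" for z
  proof -
    have "z + cnj z = complex_of_real (Re z) + complex_of_real (Re z)"
      by (simp add: complex_eq_iff)
    then have "E (z + cnj z) = (E (complex_of_real (Re z)))\<^sup>2"
      by (simp add: power2_eq_square E_add)
    moreover have "cstar_selfadjoint (E (complex_of_real (Re z)))"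
      by (simp add: cstar_selfadjoint_def E_adj)
    ultimately show ?thesis by (simp add: cstar_positive_square)
  qed
  \<comment> \<open>These are the Cauchy product coefficients of that function; in particular
    \<open>c 1 = b * a - a * b\<close>.\<close>
  define c where "c n = (\<Sum>i\<le>n. (b ^ i /\<^sub>R fact i) * (a * ((- b) ^ (n - i) /\<^sub>R fact (n - i))))" for n
  define A where "A z i = (z *\<^sub>C b) ^ i /\<^sub>R fact i" for z i
  define B where "B z i = a * ((- (z *\<^sub>C b)) ^ i /\<^sub>R fact i)" for z i
  have AB: "(\<Sum>i\<le>n. A z i * B z (n - i)) = z ^ n *\<^sub>C c n" for z n
  proof -
    have "A z i * B z (n - i) =
        z ^ n *\<^sub>C ((b ^ i /\<^sub>R fact i) * (a * ((- b) ^ (n - i) /\<^sub>R fact (n - i))))" if "i \<le> n" for i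
    proof -
      have "(- (z *\<^sub>C b)) ^ (n - i) = z ^ (n - i) *\<^sub>C (- b) ^ (n - i)"
        using scaleC_power[of z "- b"] by simp
      moreover have "z ^ n = z ^ i * z ^ (n - i)" using that by (simp flip: power_add)
      ultimately show ?thesis
        by (simp add: A_def B_def scaleC_power mult_scaleC_left mult_scaleC_right scaleC_scaleC
            scaleR_scaleC scaleC_scaleR mult_ac)
    qed
    then show ?thesis by (simp add: c_def scaleC_sum_right)
  qed
  have A_summ: "summable (\<lambda>i. norm (A z i))" for z
    unfolding A_def by (rule summable_norm_exp)
  have B_summ: "summable (\<lambda>i. norm (B z i))" for z
  proof (rule summable_comparison_test')
    show "summable (\<lambda>i. norm a * norm ((- (z *\<^sub>C b)) ^ i /\<^sub>R fact i))"
      by (intro summable_mult summable_norm_exp)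
    show "norm (norm (B z i)) \<le> norm a * norm ((- (z *\<^sub>C b)) ^ i /\<^sub>R fact i)" if "0 \<le> i" for i
      unfolding B_def real_norm_def abs_norm_cancel by (rule norm_mult_ineq)
  qed
  have A_sum: "(\<Sum>i. A z i) = E z" for z
    by (simp add: A_def E_def exp_def)
  have B_sum: "(\<Sum>i. B z i) = a * E (- z)" for z
    unfolding B_def E_def using suminf_mult[OF summable_exp_generic] by (simp add: exp_def)
  have g: "(\<Sum>n. z ^ n *\<^sub>C c n) = E z * (a * E (- z))" for z
    using Cauchy_product[OF A_summ B_summ, of z z] by (simp add: A_sum B_sum AB)
  have "c 1 = 0"
  proof (rule cstar_positive_entire_coeff_zero)
    fix r :: real assume r: "0 \<le> r"
    let ?z = "complex_of_real r"
    have sm: "summable (\<lambda>n. \<Sum>i\<le>n. norm (A ?z i) * norm (B ?z (n - i)))"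
      by (rule summable_Cauchy_product) (simp_all add: A_summ B_summ)
    have "norm (norm (c n) * r ^ n) \<le> (\<Sum>i\<le>n. norm (A ?z i) * norm (B ?z (n - i)))" for n
    proof -
      have "norm (norm (c n) * r ^ n) = norm (\<Sum>i\<le>n. A ?z i * B ?z (n - i))"
        using r by (simp add: AB norm_scaleC norm_power abs_mult)
      also have "\<dots> \<le> (\<Sum>i\<le>n. norm (A ?z i) * norm (B ?z (n - i)))"
        by (rule order_trans[OF norm_sum sum_mono]) (rule norm_mult_ineq)
      finally show ?thesis .
    qed
    then show "summable (\<lambda>n. norm (c n) * r ^ n)"
      by (rule summable_comparison_test'[OF sm, where N = 0])
  next
    fix z
    \<comment> \<open>Here \<open>d = adj (E z) * E z\<close>. Conjugation by \<open>E (- z)\<close>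
      turns \<open>d\<close> into 1, as the conjugation lemma demands, and turns the Jordan product
      of \<open>a\<close> and \<open>d\<close> into the function plus its adjoint.\<close>
    define d where "d = E (z + cnj z)"
    have d: "cstar_positive d" unfolding d_def by (rule E_pos)
    have "cstar_positive (adj (E (- z)) * (a * d + d * a) * E (- z))"
    proof (rule cstar_positive_conjugate[OF jordan[OF d] d])
      show "adj (E (- z)) * d * E (- z) = 1"
        by (simp add: d_def E_adj E_add E_zero)
    qed (simp_all add: d_def E_inv E_adj)
    moreover have "adj (E (- z)) * (a * d + d * a) * E (- z) =
        E z * (a * E (- z)) + adj (E z * (a * E (- z)))"
    proof -
      have "d * E (- z) = E (cnj z)" "adj (E (- z)) * d = E z"
        by (simp_all add: d_def E_adj E_add)
      moreover have "adj (E (- z)) * (a * d + d * a) * E (- z) =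
          adj (E (- z)) * a * (d * E (- z)) + (adj (E (- z)) * d) * (a * E (- z))"
        by (simp only: distrib_left distrib_right mult.assoc)
      moreover have "adj a = a" using a by (simp add: cstar_selfadjoint_def)
      ultimately show ?thesis by (simp add: adj_mult E_adj)
    qed
    ultimately show "cstar_positive ((\<Sum>n. z ^ n *\<^sub>C c n) + adj (\<Sum>n. z ^ n *\<^sub>C c n))"
      by (simp add: g)
  qed
  then show ?thesis by (simp add: c_def)
qed

text \<open>Every element is a complex combination of two self-adjoint ones, and \<open>a\<close>
  commutes with those.\<close>

lemma cstar_central_if_jordan_positive:
  fixes a :: "'a::cstar_algebra"
  assumes "cstar_selfadjoint a" "\<And>y. cstar_positive y \<Longrightarrow> cstar_positive (a * y + y * a)"
  shows "cstar_central a"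
  unfolding cstar_central_def
proof
  fix x :: 'a
  define p where "p = x + adj x"
  define q where "q = \<i> *\<^sub>C (x - adj x)"
  have "cstar_selfadjoint p" "cstar_selfadjoint q"
    by (simp_all add: p_def q_def cstar_selfadjoint_def adj_add adj_diff adj_scaleC adj_adj
        add.commute scaleC_diff_right)
  then have "a * p = p * a" "a * q = q * a"
    using assms commute_selfadjoint_if_jordan_positive by blast+
  moreover have "x = (1 / 2) *\<^sub>C (p - \<i> *\<^sub>C q)"
    by (simp add: p_def q_def scaleC_scaleC) (simp add: scaleC_add_right flip: scaleC_add_left)
  ultimately show "a * x = x * a"
    by (simp add: mult_scaleC_left mult_scaleC_right left_diff_distrib right_diff_distrib)
qed

theorem proposition4p3:
  fixes a :: "'a::cstar_algebra"
  assumes "a \<in> cstar_pos_def_cone"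
  shows "cstar_central a \<longleftrightarrow> (\<forall>x\<in>cstar_pos_def_cone. a \<le>\<^sub>C x \<longrightarrow> a\<^sup>2 \<le>\<^sub>C x\<^sup>2)"
proof
  have a: "cstar_positive a" "cstar_invertible a" "cstar_selfadjoint a"
    using assms by (simp_all add: cstar_pos_def_cone_def cstar_positive_def)
  {
    assume central: "cstar_central a"
    show "\<forall>x\<in>cstar_pos_def_cone. a \<le>\<^sub>C x \<longrightarrow> a\<^sup>2 \<le>\<^sub>C x\<^sup>2"
    proof (intro ballI impI)
      fix x assume "x \<in> cstar_pos_def_cone" and le: "a \<le>\<^sub>C x"
      define y where "y = x - a"
      have y: "cstar_positive y" "cstar_selfadjoint x" "x = a + y"
        using le by (simp_all add: y_def cstar_le_def)
      have "y * a = a * y" using central by (simp add: cstar_central_def)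
      then have "x\<^sup>2 - a\<^sup>2 = y\<^sup>2 + (a * y + a * y)"
        by (simp add: y(3) power2_eq_square distrib_left distrib_right)
      moreover have "cstar_positive (y\<^sup>2 + (a * y + a * y))"
        using a y(1) central by (intro cstar_positive_add cstar_positive_square
            cstar_positive_selfadjoint cstar_positive_mult_central)
      ultimately show "a\<^sup>2 \<le>\<^sub>C x\<^sup>2"
        using a y(2) by (simp add: cstar_le_def cstar_selfadjoint_power)
    qed
  next
    assume mono: "\<forall>x\<in>cstar_pos_def_cone. a \<le>\<^sub>C x \<longrightarrow> a\<^sup>2 \<le>\<^sub>C x\<^sup>2"
    show "cstar_central a"
    proof (rule cstar_central_if_jordan_positive[OF a(3)])
      fix y :: 'a assume y: "cstar_positive y"
      have y_sa: "cstar_selfadjoint y" using y by (rule cstar_positive_selfadjoint)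
      show "cstar_positive (a * y + y * a)"
      proof (rule cstar_positive_approx)
        show "cstar_selfadjoint (a * y + y * a)"
          using a(3) y_sa by (simp add: cstar_selfadjoint_def adj_add adj_mult add.commute)
        fix e :: real assume e: "0 < e"
        \<comment> \<open>A single \<open>t\<close> replaces the limit: it is small enough for the
          second-order term \<open>t *\<^sub>R y\<^sup>2\<close> to have norm at most
          \<open>e\<close>.\<close>
        define t where "t = e / (norm (y\<^sup>2) + 1)"
        have nn: "0 < norm (y\<^sup>2) + 1" by (simp add: add_nonneg_pos)
        then have t: "0 < t" using e by (simp add: t_def)
        have "t * norm (y\<^sup>2) \<le> t * (norm (y\<^sup>2) + 1)" using t by (intro mult_left_mono) simp_all
        also have "\<dots> = e" using nn by (simp add: t_def)
        finally have tn: "norm (- (t *\<^sub>R y\<^sup>2)) \<le> e" using t by simp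
        define x where "x = a + t *\<^sub>R y"
        have ty: "cstar_positive (t *\<^sub>R y)" using y t by (intro cstar_positive_scaleR) simp_all
        have "cstar_positive x"
          unfolding x_def using a(1) ty by (rule cstar_positive_add)
        \<comment> \<open>Invertibility comes from the summand \<open>a\<close>, since
          \<open>y\<close> may be singular.\<close>
        moreover have "cstar_invertible x"
          using cstar_invertible_positive_add[OF ty a(1,2)] by (simp add: x_def add.commute)
        moreover have "a \<le>\<^sub>C x"
          using ty a(3) y_sa by (simp add: cstar_le_def x_def cstar_selfadjoint_add cstar_selfadjoint_scaleR)
        ultimately have "cstar_positive (x\<^sup>2 - a\<^sup>2)"
          using mono by (simp add: cstar_pos_def_cone_def cstar_le_def)
        then have "cstar_positive ((1 / t) *\<^sub>R (x\<^sup>2 - a\<^sup>2))"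
          using t by (intro cstar_positive_scaleR) simp_all
        \<comment> \<open>Adding this positive element to the difference quotient cancels its
          second-order term and leaves the Jordan product plus \<open>e\<close>.\<close>
        moreover have "cstar_positive (- (t *\<^sub>R y\<^sup>2) + of_real e)"
        proof (rule cstar_positive_norm_add[OF _ tn])
          have "cstar_selfadjoint ((- t) *\<^sub>R y\<^sup>2)"
            using y_sa by (intro cstar_selfadjoint_scaleR cstar_selfadjoint_power)
          then show "cstar_selfadjoint (- (t *\<^sub>R y\<^sup>2))" by simp
        qed
        ultimately have "cstar_positive ((1 / t) *\<^sub>R (x\<^sup>2 - a\<^sup>2) + (- (t *\<^sub>R y\<^sup>2) + of_real e))"
          by (rule cstar_positive_add)
        moreover have "(1 / t) *\<^sub>R (x\<^sup>2 - a\<^sup>2) = a * y + y * a + t *\<^sub>R y\<^sup>2"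
          using t by (simp add: x_def power2_eq_square distrib_left distrib_right scaleR_add_right)
        ultimately show "cstar_positive (a * y + y * a + of_real e)" by simp
      qed
    qed
  }
qed

end
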